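(* Let $G$ be a graph with Gallai-Edmonds partition $V(G)=C(G)\cup A(G)\cup D(G)$, let $B_1,\dots,B_r$ be the connected components of $G[D(G)]$, let $k=|A(G)|$, and let $H$ be the associated bipartite multigraph (all defined in the context). For a maximum matching $M'$ of $H$, let $I(M')\subseteq\{1,\dots,r\}$ be the set of the $k$ indices $i$ such that the vertex $u_i$ of $H$ is covered by $M'$, and for $i\in I(M')$ let $w_i(M')\in V(B_i)$ be the endpoint in $B_i$ of the edge of $G$ corresponding to the edge of $M'$ covering $u_i$. Then the number $M_{\max}(G)$ of maximum matchings of $G$ is $$M_{\max}(G)=M_{pm}(G[C(G)])\times\Biggl[\sum_{M'}\Biggl(\ \prod_{i\in I(M')}M_{pm}\bigl(B_i-w_i(M')\bigr)\times\prod_{i\in\{1,\dots,r\}\setminus I(M')}\ \sum_{v\in V(B_i)}M_{pm}(B_i-v)\Biggr)\Biggr],$$ where the outer sum ranges over all maximum matchings $M'$ of $H$.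
   Context: Graphs are finite. A matching is a set of non-loop edges with no shared endpoints; a perfect matching saturates every vertex; a maximum matching is a matching of maximum size. $M_{\max}(\cdot)$ and $M_{pm}(\cdot)$ denote the numbers of maximum matchings and of perfect matchings respectively; the graph with no vertices has exactly one perfect matching, and empty products equal $1$. Gallai-Edmonds partition: $D(G)$ is the set of all vertices of $G$ not saturated by at least one maximum matching of $G$; $A(G)$ is the set of vertices in $V(G)\setminus D(G)$ having at least one neighbour in $D(G)$; $C(G)=V(G)\setminus(D(G)\cup A(G))$. The bipartite multigraph $H$ is obtained from $G$ by deleting the vertices of $C(G)$, deleting all edges with both endpoints in $A(G)$, and contracting each component $B_i$ of $G[D(G)]$ to a single vertex $u_i$; its parts are $A=A(G)$ and $B=\{u_1,\dots,u_r\}$. Parallel edges arising from the contraction are kept, so the edges of $H$ correspond bijectively to the edges of $G$ between $A(G)$ and $D(G)$, and matchings of $H$ are sets of such edges (two matchings using different parallel edges are different). By the Gallai-Edmonds structure theorem, every maximum matching of $H$ saturates all $k$ vertices of $A$, hence covers exactly $k$ of the vertices $u_1,\dots,u_r$. *)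

theory Defs
  imports Main
begin

text \<open>
  Undirected graphs with named edges, so that parallel edges and loops are possible. An edge with a
  one-element set of ends is a loop. A simple graph is the case where \<open>ends\<close> is injective on the
  edges and every edge has two ends. Only the values of \<open>ends\<close> on \<open>edges\<close> are meaningful.
\<close>

record ('v, 'e) multigraph =
  verts :: "'v set"
  edges :: "'e set"
  ends :: "'e \<Rightarrow> 'v set"

locale fin_multigraph =
  fixes G :: "('v, 'e) multigraph"
  assumes finite_verts: "finite (verts G)"
    and finite_edges: "finite (edges G)"
    and ends_subset: "e \<in> edges G \<Longrightarrow> ends G e \<subseteq> verts G"
    and card_ends: "e \<in> edges G \<Longrightarrow> card (ends G e) \<in> {1, 2}"

definition induced :: "('v, 'e) multigraph \<Rightarrow> 'v set \<Rightarrow> ('v, 'e) multigraph" where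
  "induced G X = \<lparr>verts = verts G \<inter> X, edges = {e \<in> edges G. ends G e \<subseteq> X}, ends = ends G\<rparr>"

definition delete_vertex :: "('v, 'e) multigraph \<Rightarrow> 'v \<Rightarrow> ('v, 'e) multigraph" where
  "delete_vertex G v = induced G (verts G - {v})"

definition adjacent :: "('v, 'e) multigraph \<Rightarrow> 'v \<Rightarrow> 'v \<Rightarrow> bool" where
  "adjacent G u v \<longleftrightarrow> (\<exists>e \<in> edges G. ends G e = {u, v})"

definition component_of :: "('v, 'e) multigraph \<Rightarrow> 'v \<Rightarrow> ('v, 'e) multigraph" where
  "component_of G v = induced G {u \<in> verts G. (adjacent G)\<^sup>*\<^sup>* v u}"

definition components :: "('v, 'e) multigraph \<Rightarrow> ('v, 'e) multigraph set" where
  "components G = component_of G ` verts G"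


definition matching :: "('v, 'e) multigraph \<Rightarrow> 'e set \<Rightarrow> bool" where
  "matching G M \<longleftrightarrow>
     M \<subseteq> edges G \<and>
     (\<forall>e \<in> M. card (ends G e) \<noteq> 1) \<and>
     (\<forall>e \<in> M. \<forall>f \<in> M. e \<noteq> f \<longrightarrow> ends G e \<inter> ends G f = {})"

definition saturates :: "('v, 'e) multigraph \<Rightarrow> 'e set \<Rightarrow> 'v \<Rightarrow> bool" where
  "saturates G M v \<longleftrightarrow> (\<exists>e \<in> M. v \<in> ends G e)"

definition perfect_matching :: "('v, 'e) multigraph \<Rightarrow> 'e set \<Rightarrow> bool" where
  "perfect_matching G M \<longleftrightarrow> matching G M \<and> (\<forall>v \<in> verts G. saturates G M v)"

definition maximum_matching :: "('v, 'e) multigraph \<Rightarrow> 'e set \<Rightarrow> bool" where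
  "maximum_matching G M \<longleftrightarrow> matching G M \<and> (\<forall>N. matching G N \<longrightarrow> card N \<le> card M)"

definition M_pm :: "('v, 'e) multigraph \<Rightarrow> nat" where
  "M_pm G = card {M. perfect_matching G M}"

definition M_max :: "('v, 'e) multigraph \<Rightarrow> nat" where
  "M_max G = card {M. maximum_matching G M}"


definition GE_D :: "('v, 'e) multigraph \<Rightarrow> 'v set" where
  "GE_D G = {v \<in> verts G. \<exists>M. maximum_matching G M \<and> \<not> saturates G M v}"

definition GE_A :: "('v, 'e) multigraph \<Rightarrow> 'v set" where
  "GE_A G = {v \<in> verts G - GE_D G. \<exists>u \<in> GE_D G. adjacent G v u}"

definition GE_C :: "('v, 'e) multigraph \<Rightarrow> 'v set" where
  "GE_C G = verts G - (GE_D G \<union> GE_A G)"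

definition D_components :: "('v, 'e) multigraph \<Rightarrow> ('v, 'e) multigraph set" where
  "D_components G = components (induced G (GE_D G))"

text \<open>
  The bipartite multigraph \<open>H\<close>. Its vertices are \<open>Inl a\<close> for \<open>a\<close> in \<open>A(G)\<close> and \<open>Inr B\<close> for the
  component \<open>B\<close> of \<open>G[D(G)]\<close>, the latter being the vertex that \<open>B\<close> is contracted to. The edges that
  survive are those of \<open>G\<close> between \<open>A(G)\<close> and \<open>D(G)\<close>. They keep their names, so parallel edges
  created by the contraction stay distinct.
\<close>

definition GE_contract :: "('v, 'e) multigraph \<Rightarrow> 'v \<Rightarrow> 'v + ('v, 'e) multigraph" where
  "GE_contract G v =
     (if v \<in> GE_D G then Inr (component_of (induced G (GE_D G)) v) else Inl v)"

definition GE_H :: "('v, 'e) multigraph \<Rightarrow> ('v + ('v, 'e) multigraph, 'e) multigraph" where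
  "GE_H G =
     \<lparr>verts = Inl ` GE_A G \<union> Inr ` D_components G,
      edges = {e \<in> edges G. \<exists>a \<in> GE_A G. \<exists>d \<in> GE_D G. ends G e = {a, d}},
      ends = (\<lambda>e. GE_contract G ` ends G e)\<rparr>"

definition covered_components ::
    "('v, 'e) multigraph \<Rightarrow> 'e set \<Rightarrow> ('v, 'e) multigraph set" where
  "covered_components G M' = {B \<in> D_components G. saturates (GE_H G) M' (Inr B)}"

text \<open>
  Meaningful when \<open>M'\<close> is a matching of \<open>H\<close> and \<open>B\<close> is one of the covered components: \<open>e\<close> is then
  the unique edge of \<open>M'\<close> at the contracted vertex.
\<close>

definition contact_vertex ::
    "('v, 'e) multigraph \<Rightarrow> 'e set \<Rightarrow> ('v, 'e) multigraph \<Rightarrow> 'v" where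
  "contact_vertex G M' B =
     (let e = (THE e. e \<in> M' \<and> Inr B \<in> ends (GE_H G) e)
      in THE v. v \<in> verts B \<and> v \<in> ends G e)"

end

theory Submission
  imports Defs "HOL-Library.FuncSet"
begin

text \<open>
  Let \<open>M\<close> be a maximum matching. An edge-by-edge exchange towards a maximum matching that misses a
  given vertex of \<open>D(G)\<close> shows that \<open>M\<close> matches \<open>A(G)\<close> into \<open>D(G)\<close>, and that deleting \<open>A(G)\<close> lowers the
  matching number by \<open>|A(G)|\<close> and keeps every vertex of \<open>D(G)\<close> inessential. Gallai's lemma in \<open>G - A(G)\<close>
  then says that at most one vertex of each component \<open>B\<close> of \<open>G[D(G)]\<close> is not matched by \<open>M\<close> inside \<open>B\<close>.
  A maximum matching that misses a vertex of \<open>B\<close> shows that \<open>|B|\<close> is odd, so there is exactly one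
  such vertex. Hence \<open>M\<close> splits into a perfect matching of \<open>G[C(G)]\<close>, a matching of \<open>H\<close> saturating
  \<open>A(G)\<close>, and near-perfect matchings of the components. All unions of such pieces have the same
  size, so they are exactly the maximum matchings.
\<close>

section \<open>Exchange arguments\<close>

lemma matching_subset: "matching G M \<Longrightarrow> N \<subseteq> M \<Longrightarrow> matching G N"
  unfolding matching_def by blast

lemma matching_unique:
  "\<lbrakk>matching G M; e \<in> M; f \<in> M; v \<in> ends G e; v \<in> ends G f\<rbrakk> \<Longrightarrow> e = f"
  unfolding matching_def by blast

lemma maximum_matchingD: "maximum_matching G M \<Longrightarrow> matching G M"
  by (simp add: maximum_matching_def)

lemma maximum_matching_card_le: "maximum_matching G M \<Longrightarrow> matching G N \<Longrightarrow> card N \<le> card M"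
  by (simp add: maximum_matching_def)

lemma maximum_matchingI:
  "matching G L \<Longrightarrow> maximum_matching G M \<Longrightarrow> card M \<le> card L \<Longrightarrow> maximum_matching G L"
  unfolding maximum_matching_def using le_trans by blast

lemma maximum_matching_card_eq:
  "maximum_matching G M \<Longrightarrow> maximum_matching G N \<Longrightarrow> card M = card N"
  unfolding maximum_matching_def by (simp add: le_antisym)

lemma GE_D_I: "\<lbrakk>v \<in> verts G; maximum_matching G M; \<not> saturates G M v\<rbrakk> \<Longrightarrow> v \<in> GE_D G"
  unfolding GE_D_def by blast

text \<open>Within the matching, \<open>f\<close> is the only edge at its ends, so removing it frees
  exactly those vertices.\<close>

lemma saturates_swap:
  assumes "matching G M" "f \<in> M"
  shows "saturates G (insert g (M - {f})) v \<longleftrightarrow> v \<in> ends G g \<or> saturates G M v \<and> v \<notin> ends G f"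
  using assms matching_unique[OF assms(1) _ assms(2)] unfolding saturates_def by blast

lemma ends_induced [simp]: "ends (induced G X) = ends G"
  and verts_induced [simp]: "verts (induced G X) = verts G \<inter> X"
  and edges_induced [simp]: "edges (induced G X) = {e \<in> edges G. ends G e \<subseteq> X}"
  by (simp_all add: induced_def)

context fin_multigraph
begin

lemma fin_multigraph_induced: "fin_multigraph (induced G X)"
  using finite_verts finite_edges ends_subset card_ends by unfold_locales auto

lemma finite_matching: "matching G M \<Longrightarrow> finite M"
  using finite_edges finite_subset unfolding matching_def by blast

lemma card_ends_matching: "matching G M \<Longrightarrow> e \<in> M \<Longrightarrow> card (ends G e) = 2"
  using card_ends unfolding matching_def by fastforce

lemma matching_other_end:
  assumes "matching G M" "e \<in> M" "v \<in> ends G e"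
  obtains w where "w \<noteq> v" "ends G e = {v, w}" "v \<in> verts G" "w \<in> verts G" "e \<in> edges G"
proof -
  have "e \<in> edges G" using assms unfolding matching_def by blast
  moreover have "\<exists>w. w \<noteq> v \<and> ends G e = {v, w}"
    using card_ends_matching[OF assms(1,2)] assms(3) unfolding card_2_iff by auto
  ultimately show ?thesis using that ends_subset by blast
qed

lemma matching_insert:
  assumes "matching G M" "e \<in> edges G" "card (ends G e) \<noteq> 1"
    and "\<And>v. v \<in> ends G e \<Longrightarrow> \<not> saturates G M v"
  shows "matching G (insert e M)" "card (insert e M) = Suc (card M)"
proof -
  show "matching G (insert e M)" using assms unfolding matching_def saturates_def by blast
  have "ends G e \<noteq> {}" using card_ends[OF assms(2)] by auto
  then have "e \<notin> M" using assms(4) unfolding saturates_def by blast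
  then show "card (insert e M) = Suc (card M)" using finite_matching[OF assms(1)] by simp
qed

text \<open>Removing \<open>f\<close> frees its ends, so only the ends of \<open>g\<close> outside
  \<open>f\<close> have to be missed by \<open>M\<close>.\<close>

lemma matching_swap:
  assumes "matching G M" "f \<in> M" "g \<in> edges G" "card (ends G g) \<noteq> 1"
    and "\<And>v. v \<in> ends G g \<Longrightarrow> v \<notin> ends G f \<Longrightarrow> \<not> saturates G M v"
  shows "matching G (insert g (M - {f}))" "card (insert g (M - {f})) = card M"
proof -
  have *: "\<not> saturates G (M - {f}) v" if "v \<in> ends G g" for v
    using that assms(5)[of v] assms(2) matching_unique[OF assms(1) _ assms(2), of _ v]
    unfolding saturates_def by blast
  note ins = matching_insert[OF matching_subset[OF assms(1), of "M - {f}"] assms(3,4) *]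
  show "matching G (insert g (M - {f}))" using ins(1) by blast
  show "card (insert g (M - {f})) = card M"
    using ins(2) card_Suc_Diff1[OF finite_matching[OF assms(1)] assms(2)] by auto
qed

lemma ex_maximum_matching: "\<exists>M. maximum_matching G M"
proof -
  have "matching G {}" by (simp add: matching_def)
  moreover have "card M \<le> card (edges G)" if "matching G M" for M
    using that by (intro card_mono[OF finite_edges]) (simp add: matching_def)
  ultimately have "\<exists>M. matching G M \<and> (\<forall>N. matching G N \<longrightarrow> card N \<le> card M)"
    by (intro ex_has_greatest_nat[where b = "Suc (card (edges G))"])
      (auto simp: less_Suc_eq_le)
  then show ?thesis by (simp add: maximum_matching_def)
qed

text \<open>An edge with all ends missed could be added to \<open>M\<close>. This supplies the next
  edge whenever an alternating path is followed.\<close>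

lemma maximum_matching_no_augment:
  assumes "maximum_matching G M" "e \<in> edges G" "card (ends G e) \<noteq> 1"
  shows "\<exists>v \<in> ends G e. saturates G M v"
proof (rule ccontr)
  assume "\<not> ?thesis"
  with matching_insert[OF maximum_matchingD[OF assms(1)] assms(2,3)]
  have "matching G (insert e M)" "card (insert e M) = Suc (card M)" by blast+
  with maximum_matching_card_le[OF assms(1)] show False by fastforce
qed

text \<open>The saturated vertices are a disjoint union of two-element end sets. Hence matchings of
  equal size saturate equally many vertices, and a saturated set has even size.\<close>

lemma card_saturated:
  assumes "matching G M"
  shows "card {v. saturates G M v} = 2 * card M"
proof -
  have "{v. saturates G M v} = \<Union> (ends G ` M)" by (auto simp: saturates_def)
  moreover have "card (\<Union> (ends G ` M)) = (\<Sum>e\<in>M. card (ends G e))"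
  proof (rule card_UN_disjoint)
    show "finite M" by (rule finite_matching[OF assms])
    \<comment> \<open>Infinite sets have cardinality 0, so end sets of cardinality 2 are
      finite.\<close>
    show "\<forall>e\<in>M. finite (ends G e)"
      using card_ends_matching[OF assms] card.infinite by fastforce
    show "\<forall>i\<in>M. \<forall>j\<in>M. i \<noteq> j \<longrightarrow> ends G i \<inter> ends G j = {}"
      using assms by (simp add: matching_def)
  qed
  ultimately show ?thesis using card_ends_matching[OF assms] by simp
qed

lemma saturated_in_verts: "matching G M \<Longrightarrow> saturates G M v \<Longrightarrow> v \<in> verts G"
  unfolding saturates_def using matching_other_end by metis

text \<open>
  The effect of switching \<open>L\<close> along the component of \<open>L \<triangle> N\<close> that starts at \<open>d\<close>, obtained one edge at
  a time. The other end of that component is missed by the switched \<open>N\<close>, hence lies in \<open>D(G)\<close>.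
\<close>

lemma exchange:
  assumes L: "matching G L" and "maximum_matching G N" "\<not> saturates G N d" "d \<in> verts G"
  shows "\<exists>L'. matching G L' \<and> card L' = card L \<and> L \<inter> N \<subseteq> L' \<and> \<not> saturates G L' d \<and>
    (\<forall>v. v \<notin> GE_D G \<longrightarrow> saturates G L' v \<longrightarrow> saturates G L v)"
  using assms(2-)
proof (induction "card (L - N)" arbitrary: N d rule: less_induct)
  case less
  note N = less.prems(1) and Nm = maximum_matchingD[OF less.prems(1)]
  show ?case
  proof (cases "saturates G L d")
    case False
    then show ?thesis using L by blast
  next
    case True
    then obtain f where f: "f \<in> L" "d \<in> ends G f" unfolding saturates_def by blast
    obtain x where x: "x \<noteq> d" "ends G f = {d, x}" "f \<in> edges G"
      using matching_other_end[OF L f] by metis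
    have cf: "card (ends G f) \<noteq> 1" using x by simp
    \<comment> \<open>If \<open>N\<close> missed \<open>x\<close> as well as \<open>d\<close>,
      adding \<open>f\<close> would enlarge it.\<close>
    obtain g where g: "g \<in> N" "x \<in> ends G g"
      using maximum_matching_no_augment[OF N x(3) cf] less.prems(2) x(2) unfolding saturates_def by auto
    obtain y where y: "y \<noteq> x" "ends G g = {x, y}" "y \<in> verts G" "g \<in> edges G"
      using matching_other_end[OF Nm g] by metis
    have yd: "y \<noteq> d" and fN: "f \<notin> N" using g y f less.prems(2) unfolding saturates_def by auto
    have gL: "g \<notin> L" using matching_unique[OF L f(1), of g x] fN x(2) g by auto
    \<comment> \<open>Along the path \<open>d\<close>, \<open>x\<close>, \<open>y\<close>, trading
      \<open>g\<close> for \<open>f\<close> makes \<open>y\<close> the missed vertex and brings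
      \<open>N\<close> closer to \<open>L\<close>.\<close>
    let ?N = "insert f (N - {g})"
    have sw: "matching G ?N" "card ?N = card N"
      using matching_swap[OF Nm g(1) x(3) cf] x y less.prems(2) by auto
    have N': "maximum_matching G ?N" using maximum_matchingI[OF sw(1) N] sw(2) by simp
    have y': "\<not> saturates G ?N y" using saturates_swap[OF Nm g(1), of f y] x y yd by auto
    have "L - ?N \<subset> L - N" using f fN gL by blast
    then have "card (L - ?N) < card (L - N)"
      using finite_matching[OF L] by (intro psubset_card_mono) auto
    from less.hyps[OF this N' y' y(3)] obtain K where
      K: "matching G K" "card K = card L" "L \<inter> ?N \<subseteq> K" "\<not> saturates G K y"
        "\<And>v. v \<notin> GE_D G \<Longrightarrow> saturates G K v \<Longrightarrow> saturates G L v" by blast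
    \<comment> \<open>The invariant on \<open>L \<inter> N\<close> serves this purpose:
      \<open>f\<close> survives in \<open>K\<close> and can be traded back for
      \<open>g\<close>.\<close>
    have fK: "f \<in> K" using K(3) f by blast
    let ?K = "insert g (K - {f})"
    have "card (ends G g) \<noteq> 1" using y by simp
    then have "matching G ?K" "card ?K = card K"
      using matching_swap[OF K(1) fK y(4)] y K(4) x by auto
    moreover have "L \<inter> N \<subseteq> ?K" using K(3) fN by blast
    moreover have "\<not> saturates G ?K d" using saturates_swap[OF K(1) fK, of g d] x y yd by auto
    \<comment> \<open>Only the ends \<open>x\<close> and \<open>y\<close> of \<open>g\<close> can
      become saturated: \<open>L\<close> already saturates \<open>x\<close>, and \<open>y\<close>
      lies in \<open>D(G)\<close>.\<close>
    moreover have "saturates G L v" if "v \<notin> GE_D G" "saturates G ?K v" for v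
    proof -
      have "y \<in> GE_D G" using GE_D_I[OF y(3) N' y'] .
      then have "saturates G K v \<or> v = x"
        using that saturates_swap[OF K(1) fK, of g v] y by auto
      moreover have "saturates G L x" using f x unfolding saturates_def by blast
      ultimately show ?thesis using K(5) that(1) by blast
    qed
    ultimately show ?thesis using K(2) by (intro exI[of _ ?K]) auto
  qed
qed

lemma exchange_D:
  assumes "matching G L" "d \<in> GE_D G"
  shows "\<exists>L'. matching G L' \<and> card L' = card L \<and> \<not> saturates G L' d \<and>
    (\<forall>v. v \<notin> GE_D G \<longrightarrow> saturates G L' v \<longrightarrow> saturates G L v)"
proof -
  obtain N where "maximum_matching G N" "\<not> saturates G N d" "d \<in> verts G"
    using assms(2) unfolding GE_D_def by blast
  from exchange[OF assms(1) this] show ?thesis by blast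
qed

section \<open>Vertices of A(G) are matched into D(G)\<close>

lemma finite_GE_A: "finite (GE_A G)"
  using finite_verts by (simp add: GE_A_def)

lemma GE_A_neighbour:
  assumes "a \<in> GE_A G"
  obtains d e where "d \<in> GE_D G" "e \<in> edges G" "ends G e = {a, d}" "a \<noteq> d" "a \<notin> GE_D G"
  using assms unfolding GE_A_def adjacent_def by blast

text \<open>Add an edge from a missed vertex of \<open>A(G)\<close> to a vertex of \<open>D(G)\<close> freed by an exchange.\<close>

lemma cover_GE_A:
  assumes "matching G L" "a \<in> GE_A G" "\<not> saturates G L a"
  obtains L' where "matching G L'" "card L' = Suc (card L)"
    "\<And>v. v \<notin> GE_D G \<Longrightarrow> v \<noteq> a \<Longrightarrow> saturates G L' v \<Longrightarrow> saturates G L v"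
proof -
  obtain d e where d: "d \<in> GE_D G" "e \<in> edges G" "ends G e = {a, d}" "a \<noteq> d" "a \<notin> GE_D G"
    using GE_A_neighbour[OF assms(2)] .
  obtain K where K: "matching G K" "card K = card L" "\<not> saturates G K d"
    "\<And>v. v \<notin> GE_D G \<Longrightarrow> saturates G K v \<Longrightarrow> saturates G L v"
    using exchange_D[OF assms(1) d(1)] by blast
  have "card (ends G e) \<noteq> 1" using d by simp
  moreover have "\<not> saturates G K v" if "v \<in> ends G e" for v using that d K assms(3) by auto
  ultimately have "matching G (insert e K)" "card (insert e K) = Suc (card K)"
    using matching_insert[OF K(1) d(2)] by auto
  then show ?thesis using that[of "insert e K"] K d by (auto simp: saturates_def)
qed

text \<open>Cover the vertices of \<open>S\<close> one after another. Each raises the size by one,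
  and the final matching is at most as large as \<open>M\<close>.\<close>

lemma card_missing_GE_A:
  assumes "finite S" "S \<subseteq> GE_A G" "matching G L" "\<And>v. v \<in> S \<Longrightarrow> \<not> saturates G L v"
    and M: "maximum_matching G M"
  shows "card L + card S \<le> card M"
  using assms(1-4)
proof (induction S arbitrary: L rule: finite_induct)
  case empty
  then show ?case using maximum_matching_card_le[OF M] by simp
next
  case (insert a S)
  obtain L' where L': "matching G L'" "card L' = Suc (card L)"
    "\<And>v. v \<notin> GE_D G \<Longrightarrow> v \<noteq> a \<Longrightarrow> saturates G L' v \<Longrightarrow> saturates G L v"
    using cover_GE_A[of L a] insert.prems by auto
  \<comment> \<open>Vertices of \<open>A(G)\<close> lie outside \<open>D(G)\<close>, so covering
    \<open>a\<close> leaves the rest of \<open>S\<close> missed.\<close>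
  have "\<not> saturates G L' v" if "v \<in> S" for v
    using that L'(3)[of v] insert.prems(1,3) insert.hyps unfolding GE_A_def by auto
  then show ?case using insert.IH[OF _ L'(1)] insert.prems insert.hyps L'(2) by auto
qed

lemma not_GE_D_saturated:
  "\<lbrakk>maximum_matching G M; v \<in> verts G; v \<notin> GE_D G\<rbrakk> \<Longrightarrow> saturates G M v"
  unfolding GE_D_def by blast

text \<open>Suppose the other end \<open>b\<close> were outside \<open>D(G)\<close>. Deleting
  \<open>e\<close> and covering \<open>a\<close> again gives a matching of the size of
  \<open>M\<close> that misses \<open>b\<close>, which puts \<open>b\<close> in
  \<open>D(G)\<close>.\<close>

lemma GE_A_matched_to_GE_D:
  assumes M: "maximum_matching G M" and e: "e \<in> M" "a \<in> ends G e" "a \<in> GE_A G"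
  obtains d where "d \<in> GE_D G" "ends G e = {a, d}" "a \<noteq> d" "e \<in> edges G"
proof -
  note Mm = maximum_matchingD[OF M]
  obtain b where b: "b \<noteq> a" "ends G e = {a, b}" "b \<in> verts G" "e \<in> edges G"
    using matching_other_end[OF Mm e(1,2)] by metis
  have "b \<in> GE_D G"
  proof (rule ccontr)
    assume bD: "b \<notin> GE_D G"
    have un: "\<not> saturates G (M - {e}) v" if "v \<in> ends G e" for v
      using matching_unique[OF Mm e(1) _ that] by (auto simp: saturates_def)
    obtain L where L: "matching G L" "card L = Suc (card (M - {e}))"
      "\<And>v. v \<notin> GE_D G \<Longrightarrow> v \<noteq> a \<Longrightarrow> saturates G L v \<Longrightarrow> saturates G (M - {e}) v"
      using cover_GE_A[OF matching_subset[OF Mm] e(3) un[OF e(2)]] by blast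
    have "card L = card M" using L(2) card_Suc_Diff1[OF finite_matching[OF Mm] e(1)] by simp
    then have "maximum_matching G L" using maximum_matchingI[OF L(1) M] by simp
    moreover have "\<not> saturates G L b" using L(3)[OF bD b(1)] un[of b] b(2) by auto
    ultimately show False using bD GE_D_I[OF b(3)] by simp
  qed
  then show ?thesis using that b by metis
qed

section \<open>Gallai's lemma\<close>

text \<open>
  Gallai's argument: if \<open>M\<close> misses \<open>u\<close> and \<open>v\<close>, and \<open>N\<close> misses \<open>t\<close>, then a counting argument yields a
  vertex other than \<open>t\<close> at which an edge of \<open>M\<close> can be swapped into \<open>N\<close>, so \<open>M \<inter> N\<close> grows forever.
\<close>

lemma inseparable_trans:
  assumes t: "t \<in> GE_D G" and M: "maximum_matching G M" and "u \<noteq> v"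
    and ut: "\<And>N. maximum_matching G N \<Longrightarrow> saturates G N u \<or> saturates G N t"
    and tv: "\<And>N. maximum_matching G N \<Longrightarrow> saturates G N t \<or> saturates G N v"
  shows "saturates G M u \<or> saturates G M v"
proof (rule ccontr)
  assume nsat: "\<not> ?thesis"
  note Mm = maximum_matchingD[OF M]
  have False if "maximum_matching G N" "\<not> saturates G N t" for N
    using that
  proof (induction "card (M - N)" arbitrary: N rule: less_induct)
    case less
    note N = less.prems(1) and Nm = maximum_matchingD[OF less.prems(1)]
    let ?SM = "{x. saturates G M x}" and ?SN = "{x. saturates G N x}"
    have fin: "finite ?SM" "finite ?SN"
      using saturated_in_verts[OF Mm] saturated_in_verts[OF Nm]
      by (auto intro: finite_subset[OF _ finite_verts])
    have "card (?SN - ?SM) = card (?SM - ?SN)"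
      using card_saturated[OF Mm] card_saturated[OF Nm] maximum_matching_card_eq[OF M N] fin
      by (intro antisym card_le_sym_Diff) auto
    \<comment> \<open>As \<open>N\<close> misses \<open>t\<close>, it saturates both
      \<open>u\<close> and \<open>v\<close>, which \<open>M\<close> misses. Equal sizes then give
      two vertices saturated by \<open>M\<close> only, one of them different from
      \<open>t\<close>.\<close>
    moreover have "{u, v} \<subseteq> ?SN - ?SM" using ut[OF N] tv[OF N] less.prems(2) nsat by blast
    then have "card {u, v} \<le> card (?SN - ?SM)" using fin by (intro card_mono) auto
    ultimately have "2 \<le> card (?SM - ?SN)" using \<open>u \<noteq> v\<close> by simp
    then have "\<not> ?SM - ?SN \<subseteq> {t}" using card_mono[of "{t}" "?SM - ?SN"] by auto
    then obtain x where x: "saturates G M x" "\<not> saturates G N x" "x \<noteq> t" by blast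
    then obtain e where e: "e \<in> M" "x \<in> ends G e" unfolding saturates_def by blast
    obtain y where y: "y \<noteq> x" "ends G e = {x, y}" "e \<in> edges G"
      using matching_other_end[OF Mm e] by metis
    have ce: "card (ends G e) \<noteq> 1" using y by simp
    obtain f where f: "f \<in> N" "y \<in> ends G f"
      using maximum_matching_no_augment[OF N y(3) ce] x(2) y(2) unfolding saturates_def by auto
    then have ySat: "saturates G N y" unfolding saturates_def by blast
    have xf: "x \<notin> ends G f" and eN: "e \<notin> N" using x(2) f e unfolding saturates_def by blast+
    have fM: "f \<notin> M" using matching_unique[OF Mm e(1), of f y] f y xf by auto
    let ?N = "insert e (N - {f})"
    have "\<not> saturates G N w" if "w \<in> ends G e" "w \<notin> ends G f" for w
      using that x(2) y(2) f(2) by auto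
    then have "matching G ?N" "card ?N = card N"
      using matching_swap[OF Nm f(1) y(3) ce] by blast+
    then have N': "maximum_matching G ?N" using maximum_matchingI[OF _ N] by simp
    \<comment> \<open>The new edge avoids \<open>t\<close>: its end \<open>x\<close> was chosen
      different from \<open>t\<close>, and its end \<open>y\<close> is saturated by
      \<open>N\<close>.\<close>
    have t': "\<not> saturates G ?N t"
      using saturates_swap[OF Nm f(1), of e t] y(2) x(3) less.prems(2) ySat by auto
    have "M - ?N \<subset> M - N" using e eN fM by blast
    then have "card (M - ?N) < card (M - N)"
      using finite_matching[OF Mm] by (intro psubset_card_mono) auto
    then show False using less.hyps[OF _ N' t'] by blast
  qed
  then show False using t unfolding GE_D_def by blast
qed

text \<open>Gallai's lemma, by induction along a walk in \<open>D(G)\<close>: neighbours are never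
  both missed, and \<open>inseparable_trans\<close> carries the property past the intermediate
  vertex \<open>y\<close>.\<close>

lemma connected_inseparable:
  assumes "u \<noteq> v" "maximum_matching G M"
    and "(\<lambda>x y. x \<in> GE_D G \<and> y \<in> GE_D G \<and> adjacent G x y)\<^sup>*\<^sup>* u v"
  shows "saturates G M u \<or> saturates G M v"
  using assms(3,1,2)
proof (induction arbitrary: M rule: rtranclp_induct)
  case base
  then show ?case by simp
next
  case (step y z)
  have adj: "saturates G N y \<or> saturates G N z" if "maximum_matching G N" "y \<noteq> z" for N
  proof -
    obtain e where "e \<in> edges G" "ends G e = {y, z}" using step.hyps(2) unfolding adjacent_def by blast
    then show ?thesis using maximum_matching_no_augment[OF that(1), of e] that(2) by auto
  qed
  show ?case
  \<comment> \<open>Inseparability concerns distinct vertices, so coinciding ones are treated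
    apart.\<close>
  proof (cases "u = y \<or> y = z")
    case True
    then show ?thesis using adj step by blast
  next
    case False
    show ?thesis
    proof (rule inseparable_trans[of y])
      show "y \<in> GE_D G" "maximum_matching G M" "u \<noteq> z" using step by blast+
      show "saturates G N u \<or> saturates G N y" if "maximum_matching G N" for N
        using step.IH[OF _ that] False by blast
      show "saturates G N y \<or> saturates G N z" if "maximum_matching G N" for N
        using adj[OF that] False by blast
    qed
  qed
qed

end

section \<open>Components of the inessential vertices\<close>

lemma saturates_induced [simp]: "saturates (induced G X) = saturates G"
  by (simp add: saturates_def fun_eq_iff)

lemma matching_induced:
  "matching (induced G X) P \<longleftrightarrow> matching G P \<and> (\<forall>e \<in> P. ends G e \<subseteq> X)"
  by (auto simp: matching_def)

lemma GE_D_subset: "GE_D G \<subseteq> verts G"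
  and GE_A_Int_GE_D: "GE_A G \<inter> GE_D G = {}"
  by (auto simp: GE_D_def GE_A_def)

lemma adjacent_sym: "adjacent G u v \<Longrightarrow> adjacent G v u"
  by (auto simp: adjacent_def insert_commute)

lemma adjacent_rtranclp_sym: "(adjacent G)\<^sup>*\<^sup>* u v \<Longrightarrow> (adjacent G)\<^sup>*\<^sup>* v u"
  using symp_rtranclp[of "adjacent G"] adjacent_sym by (metis sympD sympI)

abbreviation D_component_of :: "('v, 'e) multigraph \<Rightarrow> 'v \<Rightarrow> ('v, 'e) multigraph" where
  "D_component_of G v \<equiv> component_of (induced G (GE_D G)) v"

lemma induced_induced: "induced (induced G X) Y = induced G (X \<inter> Y)"
  by (simp add: induced_def Int_assoc conj_assoc)

text \<open>Collapses the nested induced subgraphs into one, so that a component is described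
  directly in \<open>G\<close>.\<close>

lemma D_component_of_induced:
  "D_component_of G v = induced G {u \<in> GE_D G. (adjacent (induced G (GE_D G)))\<^sup>*\<^sup>* v u}"
proof -
  have "GE_D G \<inter> {u \<in> verts (induced G (GE_D G)). P u} = {u \<in> GE_D G. P u}" for P
    using GE_D_subset[of G] by auto
  then show ?thesis unfolding component_of_def induced_induced by simp
qed

lemma verts_D_component_of:
  "verts (D_component_of G v) = {u \<in> GE_D G. (adjacent (induced G (GE_D G)))\<^sup>*\<^sup>* v u}"
  using GE_D_subset[of G] by (auto simp: D_component_of_induced)

lemma D_component_of_in: "v \<in> GE_D G \<Longrightarrow> D_component_of G v \<in> D_components G"
  using GE_D_subset[of G] by (auto simp: D_components_def components_def)

lemma D_components_cases:
  assumes "B \<in> D_components G"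
  obtains d where "d \<in> GE_D G" "B = D_component_of G d"
  using assms unfolding D_components_def components_def by auto

lemma D_component_of_self: "v \<in> GE_D G \<Longrightarrow> v \<in> verts (D_component_of G v)"
  by (simp add: verts_D_component_of)

lemma D_components_subset: "B \<in> D_components G \<Longrightarrow> verts B \<subseteq> GE_D G"
  by (auto simp: D_components_def components_def verts_D_component_of)

text \<open>Reachability is symmetric and transitive, and \<open>component_of\<close> depends on its
  vertex only through the reachable set. In particular, components that share a vertex are
  equal.\<close>

lemma D_component_of_eq:
  assumes "B \<in> D_components G" "v \<in> verts B"
  shows "D_component_of G v = B"
proof -
  let ?R = "(adjacent (induced G (GE_D G)))\<^sup>*\<^sup>*"
  obtain d where d: "d \<in> GE_D G" "B = D_component_of G d"
    using D_components_cases[OF assms(1)] .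
  then have "?R d v" using assms(2) by (simp add: verts_D_component_of)
  then have "?R d u \<longleftrightarrow> ?R v u" for u using adjacent_rtranclp_sym rtranclp_trans by metis
  then show ?thesis by (simp add: d(2) component_of_def)
qed

lemma D_component_connected:
  assumes "B \<in> D_components G" "u \<in> verts B" "v \<in> verts B"
  shows "(adjacent (induced G (GE_D G)))\<^sup>*\<^sup>* u v"
  using D_component_of_eq[OF assms(1,2)] assms(3) verts_D_component_of by fastforce

lemma D_component_adjacent:
  assumes "B \<in> D_components G" "u \<in> verts B" "v \<in> GE_D G" "e \<in> edges G" "ends G e = {u, v}"
  shows "v \<in> verts B"
proof -
  have "u \<in> GE_D G" using assms D_components_subset by blast
  then have "adjacent (induced G (GE_D G)) u v" using assms by (auto simp: adjacent_def)
  then have "v \<in> verts (D_component_of G u)" using assms(3) by (auto simp: verts_D_component_of)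
  then show ?thesis using D_component_of_eq[OF assms(1,2)] by simp
qed

lemma D_components_nonempty:
  assumes "B \<in> D_components G"
  obtains d where "d \<in> verts B"
proof -
  obtain d where "d \<in> GE_D G" "B = D_component_of G d"
    using D_components_cases[OF assms] .
  then show ?thesis using that D_component_of_self by metis
qed

lemma D_components_induced:
  assumes "B \<in> D_components G"
  shows "induced G (verts B) = B"
proof -
  obtain d where "B = D_component_of G d"
    using D_components_cases[OF assms] .
  then show ?thesis by (simp only: verts_D_component_of) (simp only: D_component_of_induced)
qed

lemma edges_D_component:
  assumes "B \<in> D_components G"
  shows "edges B = {e \<in> edges G. ends G e \<subseteq> verts B}"
  using D_components_induced[OF assms] edges_induced by metis

lemma delete_vertex_D_component:
  assumes "B \<in> D_components G"
  shows "delete_vertex B v = induced G (verts B - {v})"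
proof -
  have "delete_vertex B v = induced (induced G (verts B)) (verts B - {v})"
    using D_components_induced[OF assms] by (simp add: delete_vertex_def)
  also have "\<dots> = induced G (verts B - {v})" by (simp add: induced_induced Int_absorb1)
  finally show ?thesis .
qed

context fin_multigraph
begin

text \<open>Lets perfect matchings of induced subgraphs be treated as matchings of \<open>G\<close>;
  the condition that edges stay inside \<open>X\<close> is absorbed into the saturated set.\<close>

lemma perfect_matching_induced:
  assumes "X \<subseteq> verts G"
  shows "perfect_matching (induced G X) P \<longleftrightarrow> matching G P \<and> {v. saturates G P v} = X"
  using assms unfolding perfect_matching_def matching_induced
  by (auto simp: saturates_def)

lemma card_perfect_matching_induced:
  assumes "X \<subseteq> verts G" "perfect_matching (induced G X) P"
  shows "2 * card P = card X"
  using assms card_saturated[of P] by (auto simp: perfect_matching_induced)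

lemma finite_D_components: "finite (D_components G)"
  using finite_verts by (simp add: D_components_def components_def)

lemma D_components_verts: "B \<in> D_components G \<Longrightarrow> verts B \<subseteq> verts G"
  using D_components_subset[of B G] GE_D_subset[of G] by blast

section \<open>Deleting A(G), and matchings inside a component\<close>

text \<open>At most \<open>|A(G)|\<close> edges of \<open>M\<close> meet \<open>A(G)\<close>. A
  matching of \<open>G - A(G)\<close> misses all of \<open>A(G)\<close> and so is at least
  \<open>|A(G)|\<close> smaller than \<open>M\<close>.\<close>

lemma maximum_matching_minus_GE_A:
  assumes M: "maximum_matching G M"
  shows "maximum_matching (induced G (verts G - GE_A G)) {e \<in> M. ends G e \<inter> GE_A G = {}}"
    (is "maximum_matching ?G' ?R")
proof -
  note Mm = maximum_matchingD[OF M]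
  have fM: "finite M" by (rule finite_matching[OF Mm])
  \<comment> \<open>Picks an end in \<open>A(G)\<close> of each dropped edge; distinct edges of a
    matching get distinct vertices.\<close>
  let ?g = "\<lambda>e. SOME a. a \<in> ends G e \<inter> GE_A G"
  have g: "?g e \<in> ends G e \<inter> GE_A G" if "e \<in> M - ?R" for e
    using that some_in_eq[of "ends G e \<inter> GE_A G"] by auto
  have "inj_on ?g (M - ?R)"
  proof (rule inj_onI)
    fix e f assume ef: "e \<in> M - ?R" "f \<in> M - ?R" "?g e = ?g f"
    show "e = f" using matching_unique[OF Mm, of e f "?g e"] g[OF ef(1)] g[OF ef(2)] ef by auto
  qed
  then have le: "card (M - ?R) \<le> card (GE_A G)"
    by (rule card_inj_on_le) (use g finite_GE_A in auto)
  have eq: "card M = card ?R + card (M - ?R)"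
    using card_Un_disjoint[of ?R "M - ?R"] fM by (simp add: Un_absorb1)
  have "card L \<le> card ?R" if "matching ?G' L" for L
  proof -
    have "card L + card (GE_A G) \<le> card M"
      using that by (intro card_missing_GE_A[OF finite_GE_A _ _ _ M]) (auto simp: matching_induced saturates_def)
    then show ?thesis using le eq by linarith
  qed
  moreover have "matching G ?R" by (rule matching_subset[OF Mm]) blast
  moreover have "ends G e \<subseteq> verts G" if "e \<in> M" for e
    using that Mm ends_subset unfolding matching_def by blast
  ultimately show ?thesis by (auto simp: maximum_matching_def matching_induced)
qed

text \<open>A maximum matching that misses \<open>d\<close> still misses it once its edges at
  \<open>A(G)\<close> are dropped, and what remains is maximum in \<open>G - A(G)\<close>.\<close>

lemma GE_D_minus_GE_A: "GE_D G \<subseteq> GE_D (induced G (verts G - GE_A G))"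
proof
  fix d assume d: "d \<in> GE_D G"
  then obtain N where N: "maximum_matching G N" "\<not> saturates G N d" "d \<in> verts G"
    unfolding GE_D_def by blast
  show "d \<in> GE_D (induced G (verts G - GE_A G))"
    by (rule GE_D_I[OF _ maximum_matching_minus_GE_A[OF N(1)]])
      (use N d GE_A_Int_GE_D[of G] in \<open>auto simp: saturates_def\<close>)
qed

text \<open>A neighbour of \<open>D(G)\<close> outside \<open>D(G)\<close> belongs to
  \<open>A(G)\<close>. Hence an edge of \<open>M\<close> at \<open>v\<close> that avoids
  \<open>A(G)\<close> stays inside the component.\<close>

lemma D_component_saturates:
  assumes M: "maximum_matching G M" and B: "B \<in> D_components G" "v \<in> verts B"
  shows "saturates G {e \<in> M. ends G e \<inter> GE_A G = {}} v \<longleftrightarrow> saturates G (M \<inter> edges B) v"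
proof
  note Mm = maximum_matchingD[OF M]
  have vD: "v \<in> GE_D G" using D_components_subset[OF B(1)] B(2) by blast
  assume "saturates G {e \<in> M. ends G e \<inter> GE_A G = {}} v"
  then obtain e where e: "e \<in> M" "v \<in> ends G e" "ends G e \<inter> GE_A G = {}"
    by (auto simp: saturates_def)
  obtain w where w: "w \<noteq> v" "ends G e = {v, w}" "w \<in> verts G" "e \<in> edges G"
    using matching_other_end[OF Mm e(1,2)] by metis
  have "w \<in> GE_D G"
  proof (rule ccontr)
    assume "w \<notin> GE_D G"
    moreover have "adjacent G w v" using w by (auto simp: adjacent_def insert_commute)
    ultimately show False using e(3) w vD by (auto simp: GE_A_def)
  qed
  then have "w \<in> verts B" using D_component_adjacent[OF B _ w(4,2)] by blast
  then show "saturates G (M \<inter> edges B) v"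
    using e w B by (auto simp: saturates_def edges_D_component)
next
  assume "saturates G (M \<inter> edges B) v"
  then show "saturates G {e \<in> M. ends G e \<inter> GE_A G = {}} v"
    using D_components_subset[OF B(1)] GE_A_Int_GE_D[of G] edges_D_component[OF B(1)]
    by (fastforce simp: saturates_def)
qed

text \<open>Gallai's lemma is applied in \<open>G - A(G)\<close>, where the restriction of
  \<open>M\<close> matches vertices of \<open>B\<close> only inside \<open>B\<close>.\<close>

lemma D_component_inseparable:
  assumes M: "maximum_matching G M" and B: "B \<in> D_components G" "u \<in> verts B" "v \<in> verts B" "u \<noteq> v"
  shows "saturates G (M \<inter> edges B) u \<or> saturates G (M \<inter> edges B) v"
proof -
  let ?G' = "induced G (verts G - GE_A G)"
  \<comment> \<open>Each step of a walk in \<open>G[D(G)]\<close> is a step between inessential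
    vertices of \<open>G - A(G)\<close>.\<close>
  have "x \<in> GE_D ?G' \<and> y \<in> GE_D ?G' \<and> adjacent ?G' x y"
    if adj: "adjacent (induced G (GE_D G)) x y" for x y
  proof -
    obtain e where "e \<in> edges G" "ends G e = {x, y}" "ends G e \<subseteq> GE_D G"
      using adj unfolding adjacent_def by auto
    then have e: "e \<in> edges G" "ends G e = {x, y}" "x \<in> GE_D G" "y \<in> GE_D G" by simp_all
    then have "ends G e \<subseteq> verts G - GE_A G" using GE_A_Int_GE_D[of G] GE_D_subset[of G] by auto
    with e have "adjacent ?G' x y" unfolding adjacent_def by auto
    then show ?thesis using e GE_D_minus_GE_A by blast
  qed
  then have "(\<lambda>x y. x \<in> GE_D ?G' \<and> y \<in> GE_D ?G' \<and> adjacent ?G' x y)\<^sup>*\<^sup>* u v"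
    by (intro mono_rtranclp[rule_format, OF _ D_component_connected[OF B(1-3)]])
  then show ?thesis
    using fin_multigraph.connected_inseparable[OF fin_multigraph_induced B(4)
        maximum_matching_minus_GE_A[OF M]] D_component_saturates[OF M B(1)] B(2,3)
    by simp
qed

text \<open>By inseparability, one unsaturated vertex \<open>w\<close> forces all other vertices of
  \<open>B\<close> to be saturated inside \<open>B\<close>.\<close>

lemma D_component_saturated_except:
  assumes M: "maximum_matching G M" and B: "B \<in> D_components G" "w \<in> verts B"
    and w: "\<not> saturates G (M \<inter> edges B) w"
  shows "perfect_matching (delete_vertex B w) (M \<inter> edges B)"
proof -
  have "matching G (M \<inter> edges B)"
    by (rule matching_subset[OF maximum_matchingD[OF M]]) blast
  moreover have "{v. saturates G (M \<inter> edges B) v} \<subseteq> verts B"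
    using edges_D_component[OF B(1)] by (auto simp: saturates_def)
  ultimately show ?thesis
    using w D_component_inseparable[OF M B] D_components_verts[OF B(1)]
    unfolding delete_vertex_D_component[OF B(1)]
    by (subst perfect_matching_induced) auto
qed

text \<open>A maximum matching that misses a vertex \<open>d\<close> of \<open>B\<close> contains a
  perfect matching of \<open>B - d\<close>.\<close>

lemma odd_D_component:
  assumes B: "B \<in> D_components G"
  shows "odd (card (verts B))"
proof -
  obtain d where d: "d \<in> verts B" using D_components_nonempty[OF B] .
  then obtain N where N: "maximum_matching G N" "\<not> saturates G N d"
    using D_components_subset[OF B] unfolding GE_D_def by blast
  have "\<not> saturates G (N \<inter> edges B) d" using N(2) by (auto simp: saturates_def)
  then have "perfect_matching (delete_vertex B d) (N \<inter> edges B)"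
    by (rule D_component_saturated_except[OF N(1) B d])
  then have "2 * card (N \<inter> edges B) = card (verts B - {d})"
    using D_components_verts[OF B] card_perfect_matching_induced[of "verts B - {d}"]
    by (auto simp: delete_vertex_D_component[OF B])
  moreover have "finite (verts B)" using D_components_verts[OF B] finite_verts finite_subset by blast
  ultimately have "card (verts B) = Suc (2 * card (N \<inter> edges B))"
    using d by (metis card_Suc_Diff1)
  then show ?thesis by simp
qed

text \<open>A matching inside \<open>B\<close> saturates an even number of vertices, whereas
  \<open>B\<close> has an odd number.\<close>

lemma D_component_defect:
  assumes M: "maximum_matching G M" and B: "B \<in> D_components G"
  obtains w where "w \<in> verts B" "\<not> saturates G (M \<inter> edges B) w"
proof -
  have m: "matching G (M \<inter> edges B)"
    by (rule matching_subset[OF maximum_matchingD[OF M]]) blast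
  have "{v. saturates G (M \<inter> edges B) v} \<subseteq> verts B"
    using edges_D_component[OF B] by (auto simp: saturates_def)
  moreover have "{v. saturates G (M \<inter> edges B) v} \<noteq> verts B"
    using card_saturated[OF m] odd_D_component[OF B] by auto
  ultimately show ?thesis using that by blast
qed

end

section \<open>The contracted bipartite graph and gluing\<close>

lemma edges_GE_H_cases:
  assumes "e \<in> edges (GE_H G)"
  obtains a d where "a \<in> GE_A G" "d \<in> GE_D G" "ends G e = {a, d}" "e \<in> edges G" "a \<notin> GE_D G"
    "ends (GE_H G) e = {Inl a, Inr (D_component_of G d)}"
proof -
  obtain a d where ad: "a \<in> GE_A G" "d \<in> GE_D G" "ends G e = {a, d}" "e \<in> edges G"
    using assms unfolding GE_H_def by auto
  moreover have "a \<notin> GE_D G" using ad(1) GE_A_Int_GE_D[of G] by blast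
  ultimately show ?thesis using that by (simp add: GE_H_def GE_contract_def)
qed

text \<open>End sets with disjoint images under the contraction are disjoint. An edge of
  \<open>H\<close> is no loop of \<open>G\<close>, since one end lies in \<open>D(G)\<close> and the
  other does not.\<close>

lemma matching_GE_H_imp_matching:
  assumes "matching (GE_H G) M'"
  shows "matching G M'"
  unfolding matching_def
proof (intro conjI ballI impI)
  have M': "M' \<subseteq> edges (GE_H G)" using assms by (simp add: matching_def)
  show "M' \<subseteq> edges G" using M' by (auto simp: GE_H_def)
  show "card (ends G e) \<noteq> 1" if e: "e \<in> M'" for e
  proof -
    obtain a d where "ends G e = {a, d}" "d \<in> GE_D G" "a \<notin> GE_D G"
      using edges_GE_H_cases[of e G] e M' by (metis subsetD)
    then show ?thesis by (cases "a = d") auto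
  qed
  show "ends G e \<inter> ends G f = {}" if "e \<in> M'" "f \<in> M'" "e \<noteq> f" for e f
  proof -
    have "GE_contract G ` ends G e \<inter> GE_contract G ` ends G f = {}"
      using assms that unfolding matching_def GE_H_def by simp
    then show ?thesis by blast
  qed
qed

text \<open>Evaluates both definite descriptions in \<open>contact_vertex\<close>: \<open>M'\<close>
  has only one edge at the contracted vertex, and that edge has only one end in
  \<open>D(G)\<close>.\<close>

lemma contact_vertex_eq:
  assumes M': "matching (GE_H G) M'" and e: "e \<in> M'"
    and B: "B \<in> D_components G" "d \<in> ends G e" "d \<in> verts B"
  shows "B \<in> covered_components G M'" "contact_vertex G M' B = d"
proof -
  have "e \<in> edges (GE_H G)" using M' e by (auto simp: matching_def)
  then obtain a c where c: "a \<in> GE_A G" "c \<in> GE_D G" "ends G e = {a, c}" "a \<notin> GE_D G"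
    "ends (GE_H G) e = {Inl a, Inr (D_component_of G c)}"
    using edges_GE_H_cases by metis
  have sub: "verts B \<subseteq> GE_D G" by (rule D_components_subset[OF B(1)])
  then have d: "d = c" using B c by auto
  then have in_e: "Inr B \<in> ends (GE_H G) e" using c D_component_of_eq[OF B(1,3)] by simp
  then show "B \<in> covered_components G M'"
    using B(1) e by (auto simp: covered_components_def saturates_def)
  have "(THE f. f \<in> M' \<and> Inr B \<in> ends (GE_H G) f) = e"
  proof (rule the_equality)
    fix f assume "f \<in> M' \<and> Inr B \<in> ends (GE_H G) f"
    then show "f = e" using matching_unique[OF M' _ e _ in_e] by blast
  qed (use e in_e in blast)
  moreover have "(THE v. v \<in> verts B \<and> v \<in> ends G e) = d"
    using B c d sub by (intro the_equality) auto
  ultimately show "contact_vertex G M' B = d" by (simp add: contact_vertex_def)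
qed

lemma covered_components_cases:
  assumes M': "matching (GE_H G) M'" and B: "B \<in> covered_components G M'"
  obtains e where "e \<in> M'" "contact_vertex G M' B \<in> ends G e" "contact_vertex G M' B \<in> verts B"
proof -
  obtain e where e: "e \<in> M'" "Inr B \<in> ends (GE_H G) e" and BD: "B \<in> D_components G"
    using B by (auto simp: covered_components_def saturates_def)
  have "e \<in> edges (GE_H G)" using M' e by (auto simp: matching_def)
  then obtain a c where c: "c \<in> GE_D G" "ends G e = {a, c}"
    "ends (GE_H G) e = {Inl a, Inr (D_component_of G c)}"
    using edges_GE_H_cases by metis
  then have "c \<in> verts B" using e(2) D_component_of_self[of c G] by simp
  moreover have "c \<in> ends G e" using c by simp
  ultimately show ?thesis using contact_vertex_eq(2)[OF M' e(1) BD] that e(1) by metis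
qed

section \<open>Near-perfect matchings and gluing\<close>

text \<open>The candidates for the single vertex of \<open>B\<close> that is not matched inside
  \<open>B\<close>. This treats covered and uncovered components uniformly.\<close>

definition free_vertices ::
    "('v, 'e) multigraph \<Rightarrow> 'e set \<Rightarrow> ('v, 'e) multigraph \<Rightarrow> 'v set" where
  "free_vertices G M' B =
     (if B \<in> covered_components G M' then {contact_vertex G M' B} else verts B)"

definition near_perfect_matchings ::
    "('v, 'e) multigraph \<Rightarrow> 'e set \<Rightarrow> ('v, 'e) multigraph \<Rightarrow> 'e set set" where
  "near_perfect_matchings G M' B =
     (\<Union>w \<in> free_vertices G M' B. {P. perfect_matching (delete_vertex B w) P})"

definition glue ::
    "('v, 'e) multigraph \<Rightarrow> 'e set \<Rightarrow> 'e set \<Rightarrow> (('v, 'e) multigraph \<Rightarrow> 'e set) \<Rightarrow> 'e set" where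
  "glue G X M' f = X \<union> M' \<union> (\<Union>B \<in> D_components G. f B)"

lemma free_vertices_subset:
  assumes "matching (GE_H G) M'"
  shows "free_vertices G M' B \<subseteq> verts B"
proof (cases "B \<in> covered_components G M'")
  case True
  then show ?thesis
    using covered_components_cases[OF assms True] by (metis empty_subsetI free_vertices_def insert_subset)
qed (simp add: free_vertices_def)

lemma matching_Un:
  assumes "matching G P" "matching G Q" "\<And>v. saturates G P v \<Longrightarrow> saturates G Q v \<Longrightarrow> False"
  shows "matching G (P \<union> Q)"
  unfolding matching_def
proof (intro conjI ballI impI)
  show "P \<union> Q \<subseteq> edges G" using assms(1,2) by (simp add: matching_def)
  show "card (ends G e) \<noteq> 1" if "e \<in> P \<union> Q" for e
    using assms(1,2) that by (auto simp: matching_def)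
  show "ends G e \<inter> ends G f = {}" if ef: "e \<in> P \<union> Q" "f \<in> P \<union> Q" "e \<noteq> f" for e f
  proof (rule ccontr)
    assume "ends G e \<inter> ends G f \<noteq> {}"
    then obtain v where v: "v \<in> ends G e" "v \<in> ends G f" by blast
    then have "\<not> (e \<in> P \<and> f \<in> Q)" "\<not> (e \<in> Q \<and> f \<in> P)"
      using assms(3)[of v] unfolding saturates_def by blast+
    then show False
      using matching_unique[OF assms(1) _ _ v] matching_unique[OF assms(2) _ _ v] ef by blast
  qed
qed

lemma matching_UN:
  assumes "\<And>i. i \<in> I \<Longrightarrow> matching G (P i)"
    and "\<And>i j v. \<lbrakk>i \<in> I; j \<in> I; saturates G (P i) v; saturates G (P j) v\<rbrakk> \<Longrightarrow> i = j"
  shows "matching G (\<Union>i \<in> I. P i)"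
  unfolding matching_def
proof (intro conjI ballI impI)
  show "(\<Union>i \<in> I. P i) \<subseteq> edges G" using assms(1) unfolding matching_def by blast
  show "card (ends G e) \<noteq> 1" if "e \<in> (\<Union>i \<in> I. P i)" for e
    using assms(1) that unfolding matching_def by blast
  show "ends G e \<inter> ends G f = {}" if ef: "e \<in> (\<Union>i \<in> I. P i)" "f \<in> (\<Union>i \<in> I. P i)" "e \<noteq> f" for e f
  proof (rule ccontr)
    assume "ends G e \<inter> ends G f \<noteq> {}"
    then obtain v where v: "v \<in> ends G e" "v \<in> ends G f" by blast
    obtain i j where ij: "i \<in> I" "e \<in> P i" "j \<in> I" "f \<in> P j" using ef by blast
    then have "i = j" using v assms(2)[of i j v] unfolding saturates_def by blast
    then show False using matching_unique[OF assms(1)[OF ij(1)] ij(2) _ v] ij ef(3) by blast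
  qed
qed

context fin_multigraph
begin

lemma GE_D_neighbour:
  assumes "e \<in> edges G" "ends G e = {v, w}" "v \<in> GE_D G" "w \<notin> GE_A G"
  shows "w \<in> GE_D G"
proof (rule ccontr)
  assume "w \<notin> GE_D G"
  moreover have "adjacent G w v" using assms by (auto simp: adjacent_def insert_commute)
  moreover have "w \<in> verts G" using ends_subset[OF assms(1)] assms(2) by simp
  ultimately show False using assms by (auto simp: GE_A_def)
qed

lemma D_component_edge:
  assumes "e \<in> edges G" "ends G e = {v, w}" "v \<in> GE_D G" "w \<notin> GE_A G"
  shows "e \<in> edges (D_component_of G v)"
proof -
  have B: "D_component_of G v \<in> D_components G" "v \<in> verts (D_component_of G v)"
    using assms(3) D_component_of_in D_component_of_self by metis+
  have "w \<in> verts (D_component_of G v)"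
    using D_component_adjacent[OF B GE_D_neighbour[OF assms] assms(1,2)] .
  then show ?thesis using assms(1,2) B by (simp add: edges_D_component[OF B(1)])
qed

text \<open>Every edge of \<open>H\<close> has exactly one end in \<open>A(G)\<close>, and distinct
  edges of \<open>M'\<close> have distinct ones.\<close>

lemma card_matching_GE_H:
  assumes M': "matching (GE_H G) M'"
  shows "card M' = card {a \<in> GE_A G. saturates G M' a}"
proof -
  have G': "matching G M'" by (rule matching_GE_H_imp_matching[OF M'])
  have "\<exists>a. ends G e \<inter> GE_A G = {a}" if e: "e \<in> M'" for e
  proof -
    have "e \<in> edges (GE_H G)" using M' e by (auto simp: matching_def)
    then obtain a d where "a \<in> GE_A G" "d \<in> GE_D G" "ends G e = {a, d}" "a \<notin> GE_D G"
      using edges_GE_H_cases by metis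
    then show ?thesis using GE_A_Int_GE_D[of G] by (intro exI[of _ a]) auto
  qed
  then obtain \<alpha> where \<alpha>: "\<And>e. e \<in> M' \<Longrightarrow> ends G e \<inter> GE_A G = {\<alpha> e}" by metis
  have "inj_on \<alpha> M'"
  proof (rule inj_onI)
    fix e f assume "e \<in> M'" "f \<in> M'" "\<alpha> e = \<alpha> f"
    then show "e = f" using matching_unique[OF G', of e f "\<alpha> e"] \<alpha>[of e] \<alpha>[of f] by auto
  qed
  moreover have "\<alpha> ` M' = {a \<in> GE_A G. saturates G M' a}"
  proof (intro equalityI subsetI)
    fix a assume "a \<in> \<alpha> ` M'"
    then obtain e where "e \<in> M'" "a = \<alpha> e" by blast
    then show "a \<in> {a \<in> GE_A G. saturates G M' a}" using \<alpha>[of e] by (auto simp: saturates_def)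
  next
    fix a assume "a \<in> {a \<in> GE_A G. saturates G M' a}"
    then obtain e where "e \<in> M'" "a \<in> ends G e" "a \<in> GE_A G" by (auto simp: saturates_def)
    then show "a \<in> \<alpha> ` M'" using \<alpha>[of e] by auto
  qed
  ultimately show ?thesis using card_image by metis
qed

lemma disjoint_matchings:
  assumes "matching G P" "matching G Q" "\<And>v. saturates G P v \<Longrightarrow> saturates G Q v \<Longrightarrow> False"
  shows "P \<inter> Q = {}"
proof (rule ccontr)
  assume "P \<inter> Q \<noteq> {}"
  then obtain e where e: "e \<in> P" "e \<in> Q" by blast
  then have "ends G e \<noteq> {}" using card_ends_matching[OF assms(1)] by fastforce
  then show False using assms(3) e unfolding saturates_def by blast
qed

text \<open>The last property makes \<open>P\<close> compatible with \<open>M'\<close>: if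
  \<open>B\<close> is covered then \<open>w\<close> is the contact vertex, and otherwise
  \<open>M'\<close> avoids \<open>B\<close>.\<close>

lemma near_perfect_matchings_cases:
  assumes M': "matching (GE_H G) M'" and B: "B \<in> D_components G" and P: "P \<in> near_perfect_matchings G M' B"
  obtains w where "w \<in> verts B" "matching G P" "{v. saturates G P v} = verts B - {w}"
    "\<And>v. saturates G M' v \<Longrightarrow> v \<in> verts B \<Longrightarrow> v = w"
proof -
  obtain w where w: "w \<in> free_vertices G M' B" "perfect_matching (delete_vertex B w) P"
    using P by (auto simp: near_perfect_matchings_def)
  have "verts B - {w} \<subseteq> verts G" using D_components_verts[OF B] by blast
  then have "matching G P" "{v. saturates G P v} = verts B - {w}"
    using w(2) by (simp_all add: delete_vertex_D_component[OF B] perfect_matching_induced)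
  moreover have "v = w" if sat: "saturates G M' v" "v \<in> verts B" for v
  proof -
    obtain e where "e \<in> M'" "v \<in> ends G e" using sat(1) by (auto simp: saturates_def)
    then show ?thesis using contact_vertex_eq[OF M' _ B _ sat(2)] w(1) by (auto simp: free_vertices_def)
  qed
  moreover have "w \<in> verts B" using w(1) free_vertices_subset[OF M'] by blast
  ultimately show ?thesis using that by blast
qed

text \<open>The pieces saturate disjoint vertex sets, so their union is a matching and their sizes
  add up. The resulting size depends on \<open>G\<close> alone; the identity is arranged to avoid
  subtraction and halving. Each piece can be read off again because the edge sets of
  \<open>G[C(G)]\<close>, of \<open>H\<close> and of the components are pairwise disjoint.\<close>

lemma glue:
  assumes X: "perfect_matching (induced G (GE_C G)) X" and M': "matching (GE_H G) M'"
    and A: "\<And>a. a \<in> GE_A G \<Longrightarrow> saturates G M' a"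
    and f: "\<And>B. B \<in> D_components G \<Longrightarrow> f B \<in> near_perfect_matchings G M' B"
  shows "matching G (glue G X M' f)"
    and "2 * card (glue G X M' f) + card (D_components G) =
      card (GE_C G) + 2 * card (GE_A G) + (\<Sum>B \<in> D_components G. card (verts B))"
    and "glue G X M' f \<inter> edges (induced G (GE_C G)) = X"
    and "glue G X M' f \<inter> edges (GE_H G) = M'"
    and "\<And>B. B \<in> D_components G \<Longrightarrow> glue G X M' f \<inter> edges B = f B"
proof -
  let ?F = "\<Union>B \<in> D_components G. f B"
  have "\<forall>B \<in> D_components G. \<exists>w. w \<in> verts B \<and> matching G (f B) \<and>
      {v. saturates G (f B) v} = verts B - {w} \<and>
      (\<forall>v. saturates G M' v \<longrightarrow> v \<in> verts B \<longrightarrow> v = w)"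
    using near_perfect_matchings_cases[OF M' _ f] by metis
  then obtain w where w: "\<And>B. B \<in> D_components G \<Longrightarrow> w B \<in> verts B"
    "\<And>B. B \<in> D_components G \<Longrightarrow> matching G (f B)"
    "\<And>B. B \<in> D_components G \<Longrightarrow> {v. saturates G (f B) v} = verts B - {w B}"
    "\<And>B v. B \<in> D_components G \<Longrightarrow> saturates G M' v \<Longrightarrow> v \<in> verts B \<Longrightarrow> v = w B"
    by metis
  have C: "GE_C G \<subseteq> verts G" by (auto simp: GE_C_def)
  have X': "matching G X" "{v. saturates G X v} = GE_C G"
    using X perfect_matching_induced[OF C] by simp_all
  have M'G: "matching G M'" by (rule matching_GE_H_imp_matching[OF M'])
  have M'AD: "v \<in> GE_A G \<union> GE_D G" if v: "saturates G M' v" for v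
  proof -
    obtain e where e: "e \<in> M'" "v \<in> ends G e" using v by (auto simp: saturates_def)
    then have "e \<in> edges (GE_H G)" using M' by (auto simp: matching_def)
    then show ?thesis using e(2) by (auto simp: GE_H_def)
  qed
  have same: "B = B'" if "B \<in> D_components G" "B' \<in> D_components G" "v \<in> verts B" "v \<in> verts B'" for B B' v
    using D_component_of_eq that by metis
  have fB: "saturates G (f B) v \<longleftrightarrow> v \<in> verts B \<and> v \<noteq> w B" if "B \<in> D_components G" for B v
    using w(3)[OF that] by blast
  have dist: "B = B'" if "B \<in> D_components G" "B' \<in> D_components G"
      "saturates G (f B) v" "saturates G (f B') v" for B B' v
    using same[OF that(1,2)] that(3,4) fB[OF that(1)] fB[OF that(2)] by blast
  have F: "matching G ?F" by (rule matching_UN[OF w(2) dist])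
  have satF: "\<exists>B \<in> D_components G. v \<in> verts B \<and> v \<noteq> w B" if v: "saturates G ?F v" for v
  proof -
    obtain B where "B \<in> D_components G" "saturates G (f B) v"
      using v by (auto simp: saturates_def)
    then show ?thesis using fB by blast
  qed
  have XM': False if "saturates G X v" "saturates G M' v" for v
    using that X'(2) M'AD[OF that(2)] by (auto simp: GE_C_def)
  have m1: "matching G (X \<union> M')" by (rule matching_Un[OF X'(1) M'G XM'])
  \<comment> \<open>In a component \<open>B\<close>, the matching \<open>M'\<close> can meet only
    \<open>w B\<close>, the vertex that \<open>f B\<close> leaves out.\<close>
  have XMF: False if v: "saturates G (X \<union> M') v" "saturates G ?F v" for v
  proof -
    obtain B where B: "B \<in> D_components G" "v \<in> verts B" "v \<noteq> w B" using satF[OF v(2)] by blast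
    have "\<not> saturates G M' v" using w(4)[OF B(1) _ B(2)] B(3) by blast
    then have "saturates G X v" using v(1) by (auto simp: saturates_def)
    then show False using X'(2) D_components_subset[OF B(1)] B(2) by (auto simp: GE_C_def)
  qed
  show U: "matching G (glue G X M' f)"
    unfolding glue_def by (rule matching_Un[OF m1 F XMF])
  have "card (glue G X M' f) = card (X \<union> M') + card ?F"
    unfolding glue_def
    by (rule card_Un_disjoint[OF finite_matching[OF m1] finite_matching[OF F]
          disjoint_matchings[OF m1 F XMF]])
  moreover have "card (X \<union> M') = card X + card M'"
    by (rule card_Un_disjoint[OF finite_matching[OF X'(1)] finite_matching[OF M'G]
          disjoint_matchings[OF X'(1) M'G XM']])
  moreover have "card ?F = (\<Sum>B \<in> D_components G. card (f B))"
  proof (rule card_UN_disjoint[OF finite_D_components])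
    show "\<forall>B \<in> D_components G. finite (f B)" using finite_matching w(2) by blast
    show "\<forall>B \<in> D_components G. \<forall>B' \<in> D_components G. B \<noteq> B' \<longrightarrow> f B \<inter> f B' = {}"
    proof (intro ballI impI)
      fix B B' assume B: "B \<in> D_components G" "B' \<in> D_components G" "B \<noteq> B'"
      show "f B \<inter> f B' = {}"
        by (rule disjoint_matchings[OF w(2)[OF B(1)] w(2)[OF B(2)]]) (use dist B in metis)
    qed
  qed
  moreover have "2 * card X = card (GE_C G)"
    using card_saturated[OF X'(1)] X'(2) by simp
  moreover have "{a \<in> GE_A G. saturates G M' a} = GE_A G" using A by blast
  then have "card M' = card (GE_A G)" using card_matching_GE_H[OF M'] by simp
  \<comment> \<open>The summand 1 accounts for \<open>w B\<close>; summed over the components it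
    yields \<open>card (D_components G)\<close>.\<close>
  moreover have "2 * card (f B) + 1 = card (verts B)" if B: "B \<in> D_components G" for B
  proof -
    have "finite (verts B)" using D_components_verts[OF B] finite_verts finite_subset by blast
    then have "card (verts B) = Suc (card (verts B - {w B}))"
      using w(1)[OF B] by (metis card_Suc_Diff1)
    then show ?thesis using card_saturated[OF w(2)[OF B]] w(3)[OF B] by simp
  qed
  then have "(\<Sum>B \<in> D_components G. card (verts B)) = (\<Sum>B \<in> D_components G. 2 * card (f B) + 1)"
    by simp
  then have "(\<Sum>B \<in> D_components G. card (verts B)) =
      2 * (\<Sum>B \<in> D_components G. card (f B)) + card (D_components G)"
    by (simp only: sum.distrib sum_distrib_left) simp
  ultimately show "2 * card (glue G X M' f) + card (D_components G) =
      card (GE_C G) + 2 * card (GE_A G) + (\<Sum>B \<in> D_components G. card (verts B))"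
    by simp
  have Xe: "e \<in> edges G \<and> ends G e \<subseteq> GE_C G" if "e \<in> X" for e
    using X that by (auto simp: perfect_matching_def matching_def)
  have M'e: "e \<in> edges (GE_H G)" if "e \<in> M'" for e using that M' by (auto simp: matching_def)
  have fe: "e \<in> edges G \<and> ends G e \<subseteq> verts B" if "e \<in> f B" "B \<in> D_components G" for e B
    using that w(2)[OF that(2)] fB[OF that(2)] by (auto simp: matching_def saturates_def)
  \<comment> \<open>An empty end set would be contained in both \<open>C(G)\<close> and
    \<open>D(G)\<close> and spoil the disjointness of the edge sets.\<close>
  have ne: "ends G e \<noteq> {}" if "e \<in> edges G" for e using card_ends[OF that] by auto
  have C_H: "\<not> ends G e \<subseteq> GE_C G" "\<not> ends G e \<subseteq> GE_D G" if e: "e \<in> edges (GE_H G)" for e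
    using edges_GE_H_cases[OF e] by (metis (no_types, lifting) DiffD2 GE_C_def UnI2 insertI1 subsetD)+
  have C_D: "\<not> ends G e \<subseteq> GE_D G" if "e \<in> edges G" "ends G e \<subseteq> GE_C G" for e
    using ne[OF that(1)] that(2) by (auto simp: GE_C_def)
  have BD: "verts B \<subseteq> GE_D G" if "B \<in> D_components G" for B by (rule D_components_subset[OF that])
  have fD: "ends G e \<subseteq> GE_D G" if "e \<in> f B" "B \<in> D_components G" for e B
    using fe[OF that] BD[OF that(2)] by blast
  show "glue G X M' f \<inter> edges (induced G (GE_C G)) = X"
  proof (intro equalityI subsetI)
    fix e assume e: "e \<in> glue G X M' f \<inter> edges (induced G (GE_C G))"
    then have "e \<in> edges G" "ends G e \<subseteq> GE_C G" by auto
    then have "e \<notin> M'" "e \<notin> ?F" using M'e C_H(1) C_D fD by blast+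
    then show "e \<in> X" using e by (simp add: glue_def)
  qed (use Xe in \<open>auto simp: glue_def\<close>)
  show "glue G X M' f \<inter> edges (GE_H G) = M'"
  proof (intro equalityI subsetI)
    fix e assume e: "e \<in> glue G X M' f \<inter> edges (GE_H G)"
    then have "e \<notin> X" "e \<notin> ?F" using Xe C_H fD by blast+
    then show "e \<in> M'" using e by (simp add: glue_def)
  qed (use M'e in \<open>auto simp: glue_def\<close>)
  show "glue G X M' f \<inter> edges B = f B" if B: "B \<in> D_components G" for B
  proof (intro equalityI subsetI)
    fix e assume e: "e \<in> glue G X M' f \<inter> edges B"
    then have eB: "e \<in> edges G" "ends G e \<subseteq> verts B" by (auto simp: edges_D_component[OF B])
    then have "ends G e \<subseteq> GE_D G" using BD[OF B] by blast
    then have "e \<notin> X" "e \<notin> M'" using Xe C_D M'e C_H(2) by blast+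
    then obtain B' where B': "B' \<in> D_components G" "e \<in> f B'" using e by (auto simp: glue_def)
    obtain v where "v \<in> ends G e" using ne[OF eB(1)] by blast
    then have "B' = B" using same[OF B'(1) B] fe[OF B'(2,1)] eB(2) by blast
    then show "e \<in> f B" using B' by simp
  next
    fix e assume "e \<in> f B"
    then show "e \<in> glue G X M' f \<inter> edges B"
      using fe[OF _ B] B by (auto simp: glue_def edges_D_component[OF B])
  qed
qed

section \<open>Decomposing maximum matchings\<close>

text \<open>\<open>M\<close> has no edge inside \<open>A(G)\<close> or between \<open>A(G)\<close>
  and \<open>C(G)\<close>, and no edge of \<open>G\<close> joins \<open>C(G)\<close> to
  \<open>D(G)\<close>. Its traces on the three kinds of edge sets therefore exhaust it and are
  pieces that can be glued.\<close>

lemma maximum_matching_decomposition: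
  assumes M: "maximum_matching G M"
  shows "perfect_matching (induced G (GE_C G)) (M \<inter> edges (induced G (GE_C G)))"
    and "matching (GE_H G) (M \<inter> edges (GE_H G))"
    and "\<And>a. a \<in> GE_A G \<Longrightarrow> saturates G (M \<inter> edges (GE_H G)) a"
    and "\<And>B. B \<in> D_components G \<Longrightarrow>
      M \<inter> edges B \<in> near_perfect_matchings G (M \<inter> edges (GE_H G)) B"
    and "glue G (M \<inter> edges (induced G (GE_C G))) (M \<inter> edges (GE_H G)) (\<lambda>B. M \<inter> edges B) = M"
proof -
  note Mm = maximum_matchingD[OF M]
  let ?X = "M \<inter> edges (induced G (GE_C G))" and ?M' = "M \<inter> edges (GE_H G)"
  have edge: "e \<in> edges (GE_H G)" if ea: "e \<in> M" "a \<in> ends G e" "a \<in> GE_A G" for e a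
  proof -
    obtain d where "d \<in> GE_D G" "ends G e = {a, d}" "e \<in> edges G"
      using GE_A_matched_to_GE_D[OF M ea] by metis
    then show ?thesis using ea(3) by (auto simp: GE_H_def)
  qed
  \<comment> \<open>An edge of \<open>M\<close> at \<open>C(G)\<close> cannot end in
    \<open>A(G)\<close>, whose edges in \<open>M\<close> lead to \<open>D(G)\<close>, nor in
    \<open>D(G)\<close>, whose outside neighbours all lie in \<open>A(G)\<close>.\<close>
  have C: "ends G e \<subseteq> GE_C G" if e: "e \<in> M" "v \<in> ends G e" "v \<in> GE_C G" for e v
  proof -
    obtain u where u: "ends G e = {v, u}" "u \<in> verts G" "e \<in> edges G"
      using matching_other_end[OF Mm e(1,2)] by metis
    have "u \<notin> GE_A G"
    proof
      assume A: "u \<in> GE_A G"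
      have "u \<in> ends G e" using u(1) by simp
      then obtain d where "d \<in> GE_D G" "ends G e = {u, d}" "u \<noteq> d"
        using GE_A_matched_to_GE_D[OF M e(1) _ A] by metis
      then show False using u A e(3) by (auto simp: GE_C_def doubleton_eq_iff)
    qed
    moreover have "u \<notin> GE_D G"
      using GE_D_neighbour[OF u(3), of u v] u(1) e(3) by (auto simp: GE_C_def insert_commute)
    ultimately show ?thesis using u e(3) by (auto simp: GE_C_def)
  qed
  show "perfect_matching (induced G (GE_C G)) ?X"
    unfolding perfect_matching_def matching_induced
  proof (intro conjI ballI)
    show "matching G ?X" by (rule matching_subset[OF Mm]) blast
    show "ends G e \<subseteq> GE_C G" if "e \<in> ?X" for e using that by simp
    fix v assume "v \<in> verts (induced G (GE_C G))"
    then have v: "v \<in> GE_C G" "v \<in> verts G" "v \<notin> GE_D G" by (auto simp: GE_C_def)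
    then obtain e where e: "e \<in> M" "v \<in> ends G e"
      using not_GE_D_saturated[OF M v(2,3)] by (auto simp: saturates_def)
    moreover have "e \<in> edges G" using e(1) Mm by (auto simp: matching_def)
    ultimately show "saturates (induced G (GE_C G)) ?X v"
      using C[OF e v(1)] by (auto simp: saturates_def)
  qed
  \<comment> \<open>The only edge of \<open>M\<close> at \<open>d\<close> is \<open>e\<close>, and
    \<open>e\<close> is not contained in \<open>D(G)\<close>.\<close>
  have free: "\<not> saturates G (M \<inter> edges B) d"
    if B: "B \<in> D_components G" and e: "e \<in> ?M'" "d \<in> ends G e" for B e d
  proof
    assume "saturates G (M \<inter> edges B) d"
    then obtain g where g: "g \<in> M" "g \<in> edges B" "d \<in> ends G g" by (auto simp: saturates_def)
    then have "g = e" using matching_unique[OF Mm] e by blast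
    then have "ends G e \<subseteq> GE_D G"
      using g(2) D_components_subset[OF B] by (auto simp: edges_D_component[OF B])
    moreover have "e \<in> edges (GE_H G)" using e by blast
    ultimately show False using edges_GE_H_cases by (metis insertI1 subsetD)
  qed
  show M'H: "matching (GE_H G) ?M'"
    unfolding matching_def
  proof (intro conjI ballI impI)
    show "?M' \<subseteq> edges (GE_H G)" by blast
    show "card (ends (GE_H G) e) \<noteq> 1" if e: "e \<in> ?M'" for e
    proof -
      have "e \<in> edges (GE_H G)" using e by blast
      then obtain a d where "ends (GE_H G) e = {Inl a, Inr (D_component_of G d)}"
        using edges_GE_H_cases by metis
      then show ?thesis by simp
    qed
    fix e g assume eg: "e \<in> ?M'" "g \<in> ?M'" "e \<noteq> g"
    have "e \<in> edges (GE_H G)" "g \<in> edges (GE_H G)" using eg by blast+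
    obtain a d where e: "d \<in> GE_D G" "ends G e = {a, d}"
      "ends (GE_H G) e = {Inl a, Inr (D_component_of G d)}"
      using edges_GE_H_cases[OF \<open>e \<in> edges (GE_H G)\<close>] by metis
    obtain b c where g: "c \<in> GE_D G" "ends G g = {b, c}"
      "ends (GE_H G) g = {Inl b, Inr (D_component_of G c)}"
      using edges_GE_H_cases[OF \<open>g \<in> edges (GE_H G)\<close>] by metis
    have disj: "ends G e \<inter> ends G g = {}" using eg Mm by (auto simp: matching_def)
    \<comment> \<open>Otherwise \<open>d\<close> and \<open>c\<close> would be two vertices of one
      component, neither matched inside it.\<close>
    have "D_component_of G d \<noteq> D_component_of G c"
    proof
      assume eq: "D_component_of G d = D_component_of G c"
      let ?B = "D_component_of G d"
      have B: "?B \<in> D_components G" "d \<in> verts ?B" "c \<in> verts ?B"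
        using D_component_of_in[OF e(1)] D_component_of_self[OF e(1)]
          D_component_of_self[OF g(1)] eq by simp_all
      have "d \<noteq> c" using disj e(2) g(2) by auto
      then show False
        using D_component_inseparable[OF M B] free[OF B(1) eg(1), of d] free[OF B(1) eg(2), of c]
          e(2) g(2) by simp
    qed
    then show "ends (GE_H G) e \<inter> ends (GE_H G) g = {}" using disj e g by auto
  qed
  show "saturates G ?M' a" if a: "a \<in> GE_A G" for a
  proof -
    have "saturates G M a"
      using not_GE_D_saturated[OF M] a by (auto simp: GE_A_def)
    then show ?thesis using edge a by (auto simp: saturates_def)
  qed
  show "M \<inter> edges B \<in> near_perfect_matchings G ?M' B" if B: "B \<in> D_components G" for B
  proof (cases "B \<in> covered_components G ?M'")
    case True
    obtain e where e: "e \<in> ?M'" "contact_vertex G ?M' B \<in> ends G e" "contact_vertex G ?M' B \<in> verts B"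
      using covered_components_cases[OF M'H True] .
    have "perfect_matching (delete_vertex B (contact_vertex G ?M' B)) (M \<inter> edges B)"
      by (rule D_component_saturated_except[OF M B e(3) free[OF B e(1,2)]])
    then show ?thesis using True by (simp add: near_perfect_matchings_def free_vertices_def)
  next
    case False
    \<comment> \<open>No edge of \<open>M\<close> in \<open>H\<close> singles out a vertex here;
      parity supplies the one left out.\<close>
    obtain w where w: "w \<in> verts B" "\<not> saturates G (M \<inter> edges B) w"
      using D_component_defect[OF M B] .
    then have "perfect_matching (delete_vertex B w) (M \<inter> edges B)"
      by (rule D_component_saturated_except[OF M B])
    then show ?thesis using False w(1) by (auto simp: near_perfect_matchings_def free_vertices_def)
  qed
  \<comment> \<open>An edge of \<open>M\<close> that meets \<open>A(G)\<close> belongs to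
    \<open>H\<close>; of the others, those meeting \<open>D(G)\<close> lie in a component and the
    rest in \<open>C(G)\<close>.\<close>
  have "e \<in> glue G ?X ?M' (\<lambda>B. M \<inter> edges B)" if e: "e \<in> M" for e
  proof (cases "ends G e \<inter> GE_A G = {}")
    case False
    then show ?thesis using edge e by (auto simp: glue_def)
  next
    case A: True
    have eG: "e \<in> edges G" using e Mm by (auto simp: matching_def)
    show ?thesis
    proof (cases "ends G e \<inter> GE_D G = {}")
      case True
      then have "ends G e \<subseteq> GE_C G" using A ends_subset[OF eG] by (auto simp: GE_C_def)
      then show ?thesis using e eG by (simp add: glue_def)
    next
      case False
      then obtain d where d: "d \<in> ends G e" "d \<in> GE_D G" by blast
      obtain u where u: "ends G e = {d, u}" using matching_other_end[OF Mm e d(1)] by metis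
      have "u \<notin> GE_A G" using A u by auto
      then have "e \<in> edges (D_component_of G d)" by (rule D_component_edge[OF eG u d(2)])
      then show ?thesis using e D_component_of_in[OF d(2)] by (auto simp: glue_def)
    qed
  qed
  then show "glue G ?X ?M' (\<lambda>B. M \<inter> edges B) = M" by (auto simp: glue_def)
qed

text \<open>A matching of \<open>H\<close> has at most \<open>|A(G)|\<close> edges, with equality
  when all of \<open>A(G)\<close> is saturated. The trace of a maximum matching of \<open>G\<close>
  attains this bound.\<close>

lemma maximum_matching_GE_H_iff:
  "maximum_matching (GE_H G) M' \<longleftrightarrow>
    matching (GE_H G) M' \<and> (\<forall>a \<in> GE_A G. saturates G M' a)"
proof -
  have le: "card N \<le> card (GE_A G)" if "matching (GE_H G) N" for N
    using card_matching_GE_H[OF that] by (simp add: card_mono finite_GE_A)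
  have eq: "card N = card (GE_A G) \<longleftrightarrow> (\<forall>a \<in> GE_A G. saturates G N a)"
    if "matching (GE_H G) N" for N
  proof
    assume "card N = card (GE_A G)"
    then have "{a \<in> GE_A G. saturates G N a} = GE_A G"
      using card_matching_GE_H[OF that] by (intro card_subset_eq finite_GE_A) auto
    then show "\<forall>a \<in> GE_A G. saturates G N a" by blast
  next
    assume "\<forall>a \<in> GE_A G. saturates G N a"
    then have "{a \<in> GE_A G. saturates G N a} = GE_A G" by blast
    then show "card N = card (GE_A G)" using card_matching_GE_H[OF that] by simp
  qed
  obtain M where "maximum_matching G M" using ex_maximum_matching ..
  note dec = maximum_matching_decomposition[OF this]
  have "card (M \<inter> edges (GE_H G)) = card (GE_A G)" using eq[OF dec(2)] dec(3) by simp
  then have "maximum_matching (GE_H G) M' \<longleftrightarrow>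
      matching (GE_H G) M' \<and> card M' = card (GE_A G)"
    using le dec(2) unfolding maximum_matching_def by (metis le_antisym)
  then show ?thesis using eq by blast
qed

text \<open>Any maximum matching \<open>M\<close> of \<open>G\<close> is itself glued from such
  pieces, and all gluings have the same size.\<close>

lemma maximum_matching_glue:
  assumes "perfect_matching (induced G (GE_C G)) X" "maximum_matching (GE_H G) M'"
    and "\<And>B. B \<in> D_components G \<Longrightarrow> f B \<in> near_perfect_matchings G M' B"
  shows "maximum_matching G (glue G X M' f)"
proof -
  have M': "matching (GE_H G) M'" "\<And>a. a \<in> GE_A G \<Longrightarrow> saturates G M' a"
    using assms(2) by (simp_all add: maximum_matching_GE_H_iff)
  note g = glue[OF assms(1) M' assms(3)]
  obtain M where M: "maximum_matching G M" using ex_maximum_matching ..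
  note dec = maximum_matching_decomposition[OF M]
  have "card M = card (glue G X M' f)"
    using glue(2)[OF dec(1,2,3,4)] g(2) unfolding dec(5) by simp
  then show ?thesis using maximum_matchingI[OF g(1) M] by simp
qed

section \<open>Counting the pieces\<close>

lemma finite_perfect_matchings: "finite {P. perfect_matching (induced G X) P}"
  by (rule finite_subset[of _ "Pow (edges G)"])
    (auto simp: perfect_matching_def matching_def finite_edges)

text \<open>A near-perfect matching determines \<open>w\<close> as the only vertex of
  \<open>B\<close> that it misses, so the union over \<open>w\<close> is disjoint.\<close>

lemma card_near_perfect_matchings:
  assumes M': "matching (GE_H G) M'" and B: "B \<in> D_components G"
  shows "card (near_perfect_matchings G M' B) = (\<Sum>w \<in> free_vertices G M' B. M_pm (delete_vertex B w))"
  unfolding near_perfect_matchings_def M_pm_def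
proof (rule card_UN_disjoint)
  have sub: "free_vertices G M' B \<subseteq> verts B" by (rule free_vertices_subset[OF M'])
  then show "finite (free_vertices G M' B)"
    using D_components_verts[OF B] finite_verts by (meson finite_subset)
  show "\<forall>w \<in> free_vertices G M' B. finite {P. perfect_matching (delete_vertex B w) P}"
    by (simp add: delete_vertex_D_component[OF B] finite_perfect_matchings)
  have "{v. saturates G P v} = verts B - {w}" if "perfect_matching (delete_vertex B w) P" for w P
    using that D_components_verts[OF B] perfect_matching_induced[of "verts B - {w}" P]
    by (auto simp: delete_vertex_D_component[OF B])
  then have "w = u" if "w \<in> verts B" "u \<in> verts B"
    "perfect_matching (delete_vertex B w) P" "perfect_matching (delete_vertex B u) P" for w u P
    using that by blast
  then show "\<forall>w \<in> free_vertices G M' B. \<forall>u \<in> free_vertices G M' B. w \<noteq> u \<longrightarrow>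
      {P. perfect_matching (delete_vertex B w) P} \<inter> {P. perfect_matching (delete_vertex B u) P} = {}"
    using sub by blast
qed

text \<open>For a covered component the only candidate is the contact vertex, so the sum over
  candidates collapses to one term.\<close>

lemma prod_card_near_perfect_matchings:
  assumes M': "matching (GE_H G) M'"
  shows "(\<Prod>B \<in> D_components G. card (near_perfect_matchings G M' B)) =
    (\<Prod>B \<in> covered_components G M'. M_pm (delete_vertex B (contact_vertex G M' B))) *
    (\<Prod>B \<in> D_components G - covered_components G M'. \<Sum>v \<in> verts B. M_pm (delete_vertex B v))"
proof -
  have sub: "covered_components G M' \<subseteq> D_components G" by (auto simp: covered_components_def)
  have "(\<Prod>B \<in> D_components G. card (near_perfect_matchings G M' B)) =
      (\<Prod>B \<in> D_components G - covered_components G M'. card (near_perfect_matchings G M' B)) *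
      (\<Prod>B \<in> covered_components G M'. card (near_perfect_matchings G M' B))"
    by (rule prod.subset_diff[OF sub finite_D_components])
  moreover have "(\<Prod>B \<in> covered_components G M'. card (near_perfect_matchings G M' B)) =
      (\<Prod>B \<in> covered_components G M'. M_pm (delete_vertex B (contact_vertex G M' B)))"
    using sub by (intro prod.cong refl) (auto simp: card_near_perfect_matchings[OF M'] free_vertices_def)
  moreover have "(\<Prod>B \<in> D_components G - covered_components G M'. card (near_perfect_matchings G M' B)) =
      (\<Prod>B \<in> D_components G - covered_components G M'. \<Sum>v \<in> verts B. M_pm (delete_vertex B v))"
    by (intro prod.cong refl) (auto simp: card_near_perfect_matchings[OF M'] free_vertices_def)
  ultimately show ?thesis by simp
qed

text \<open>Intersecting with the edge sets of the pieces is a two-sided inverse of gluing. The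
  near-perfect matchings are chosen by a function in \<open>PiE\<close>, so that choices agreeing on
  all components are equal and counted once.\<close>

lemma bij_betw_glue:
  "bij_betw (\<lambda>(X, M', f). glue G X M' f)
    ({X. perfect_matching (induced G (GE_C G)) X} \<times>
      (SIGMA M' : {M'. maximum_matching (GE_H G) M'}. PiE (D_components G) (near_perfect_matchings G M')))
    {M. maximum_matching G M}"
    (is "bij_betw ?g ?T ?M")
proof (rule bij_betw_byWitness)
  let ?dec = "\<lambda>M. (M \<inter> edges (induced G (GE_C G)), M \<inter> edges (GE_H G),
    restrict (\<lambda>B. M \<inter> edges B) (D_components G))"
  \<comment> \<open>Gluing reads \<open>f\<close> only on the components, so making it extensional
    changes nothing.\<close>
  have restr: "glue G X M' (restrict f (D_components G)) = glue G X M' f" for X M' f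
    by (simp add: glue_def)
  have "?dec (glue G X M' f) = (X, M', f)" if X: "perfect_matching (induced G (GE_C G)) X" and M': "maximum_matching (GE_H G) M'"
      and f: "f \<in> PiE (D_components G) (near_perfect_matchings G M')" for X M' f
  proof -
    have sat: "matching (GE_H G) M'" "\<And>a. a \<in> GE_A G \<Longrightarrow> saturates G M' a"
      using M' by (simp_all add: maximum_matching_GE_H_iff)
    note g = glue[OF X sat PiE_mem[OF f]]
    have "restrict (\<lambda>B. glue G X M' f \<inter> edges B) (D_components G) = restrict f (D_components G)"
      by (rule restrict_ext) (rule g(5))
    also have "\<dots> = f" using f by (rule PiE_restrict)
    finally show ?thesis using g(3,4) by simp
  qed
  then show "\<forall>t \<in> ?T. ?dec (?g t) = t" by fast
  show "\<forall>M \<in> ?M. ?g (?dec M) = M"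
    by (simp add: restr maximum_matching_decomposition(5) del: edges_induced)
  have "maximum_matching G (glue G X M' f)"
    if "perfect_matching (induced G (GE_C G)) X" "maximum_matching (GE_H G) M'"
      "f \<in> PiE (D_components G) (near_perfect_matchings G M')" for X M' f
    by (rule maximum_matching_glue[OF that(1,2) PiE_mem[OF that(3)]])
  then show "?g ` ?T \<subseteq> ?M" by fast
  have "?dec M \<in> ?T" if "maximum_matching G M" for M
    using maximum_matching_decomposition(1-4)[OF that]
    by (simp add: maximum_matching_GE_H_iff del: edges_induced)
  then show "?dec ` ?M \<subseteq> ?T" by blast
qed

lemma finite_maximum_matchings_GE_H: "finite {M'. maximum_matching (GE_H G) M'}"
  by (rule finite_subset[of _ "Pow (edges G)"])
    (auto simp: maximum_matching_def matching_def GE_H_def finite_edges)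

end

theorem theorem2p4:
  fixes G :: "('v, 'e) multigraph"
  assumes "fin_multigraph G"
  shows "M_max G =
    M_pm (induced G (GE_C G)) *
    (\<Sum>M' \<in> {M'. maximum_matching (GE_H G) M'}.
       (\<Prod>B \<in> covered_components G M'. M_pm (delete_vertex B (contact_vertex G M' B))) *
       (\<Prod>B \<in> D_components G - covered_components G M'.
          \<Sum>v \<in> verts B. M_pm (delete_vertex B v)))"
proof -
  interpret fin_multigraph G by (rule assms)
  let ?H = "{M'. maximum_matching (GE_H G) M'}"
  let ?F = "\<lambda>M'. PiE (D_components G) (near_perfect_matchings G M')"
  have fin: "finite (?F M')" for M'
  proof (intro finite_PiE finite_D_components)
    fix B assume B: "B \<in> D_components G"
    have "near_perfect_matchings G M' B \<subseteq> Pow (edges G)"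
      by (auto simp: near_perfect_matchings_def perfect_matching_def matching_def
          delete_vertex_D_component[OF B])
    then show "finite (near_perfect_matchings G M' B)"
      using finite_edges by (meson finite_Pow_iff finite_subset)
  qed
  \<comment> \<open>The matching of \<open>G[C(G)]\<close> is chosen independently of
    \<open>M'\<close> and factors out; the near-perfect matchings depend on \<open>M'\<close> and
    stay under the sum.\<close>
  have "M_max G = M_pm (induced G (GE_C G)) * card (SIGMA M' : ?H. ?F M')"
    using bij_betw_same_card[OF bij_betw_glue] by (simp add: M_max_def M_pm_def card_cartesian_product)
  also have "card (SIGMA M' : ?H. ?F M') = (\<Sum>M' \<in> ?H. card (?F M'))"
    using finite_maximum_matchings_GE_H fin by simp
  also have "\<dots> = (\<Sum>M' \<in> ?H.
       (\<Prod>B \<in> covered_components G M'. M_pm (delete_vertex B (contact_vertex G M' B))) *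
       (\<Prod>B \<in> D_components G - covered_components G M'.
          \<Sum>v \<in> verts B. M_pm (delete_vertex B v)))"
    by (intro sum.cong refl)
      (simp add: card_PiE finite_D_components prod_card_near_perfect_matchings maximum_matchingD)
  finally show ?thesis .
qed

end
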